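(* Let $\mathcal{L}\subset\mathbb{R}^d$ be a full-rank lattice. Let $\mathcal{P},Q\subset\mathbb{R}^d$ be connected sets, each of which is a finite union of convex bodies, and suppose that each satisfies the sparse lattice property with respect to $\mathcal{L}$, i.e. $$(\mathcal{P}-\mathcal{P})\cap\mathcal{L}=\{0\}\qquad\text{and}\qquad (Q-Q)\cap\mathcal{L}=\{0\}.$$ Suppose that $$\widehat{\mathbf{1}_{\mathcal{P}}}(\xi)=\widehat{\mathbf{1}_{Q}}(\xi)\qquad\text{for every }\xi\in\mathcal{L}^*.$$ Then there is an $\ell\in\mathcal{L}$ such that $Q=\mathcal{P}+\ell$.
   Context: A body is a compact subset of $\mathbb{R}^d$ with nonempty interior; a convex body is a body that is convex. For $\mathcal{K}\subset\mathbb{R}^d$, the difference set is $\mathcal{K}-\mathcal{K}:=\{x-y:x,y\in\mathcal{K}\}$. The dual lattice is $\mathcal{L}^*:=\{\xi\in\mathbb{R}^d:\langle\xi,\ell\rangle\in\mathbb{Z}\text{ for every }\ell\in\mathcal{L}\}$. For a measurable set $\mathcal{K}\subset\mathbb{R}^d$ of finite measure, $\mathbf{1}_{\mathcal{K}}$ is its indicator function and $\widehat{\mathbf{1}_{\mathcal{K}}}(\xi):=\int_{\mathcal{K}}e^{-2\pi i\langle x,\xi\rangle}\,dx$ for $\xi\in\mathbb{R}^d$. *)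

theory Defs
  imports "HOL-Analysis.Analysis"
begin

definition body :: "'a::euclidean_space set \<Rightarrow> bool" where
  "body K \<longleftrightarrow> compact K \<and> interior K \<noteq> {}"

definition convex_body :: "'a::euclidean_space set \<Rightarrow> bool" where
  "convex_body K \<longleftrightarrow> body K \<and> convex K"

definition finite_union_of_convex_bodies :: "'a::euclidean_space set \<Rightarrow> bool" where
  "finite_union_of_convex_bodies P \<longleftrightarrow>
     (\<exists>\<C>. finite \<C> \<and> (\<forall>K\<in>\<C>. convex_body K) \<and> P = \<Union>\<C>)"

definition full_rank_lattice :: "'a::euclidean_space set \<Rightarrow> bool" where
  "full_rank_lattice L \<longleftrightarrow>
     (\<exists>B. independent B \<and> span B = UNIV \<and>
          L = {\<Sum>b\<in>B. real_of_int (c b) *\<^sub>R b | c. True})"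

definition dual_lattice :: "'a::euclidean_space set \<Rightarrow> 'a set" where
  "dual_lattice L = {\<xi>. \<forall>l\<in>L. \<xi> \<bullet> l \<in> \<int>}"

(* On sets, the operator - is the relative complement, hence a separate constant for K - K. *)
definition difference_set :: "'a::euclidean_space set \<Rightarrow> 'a set" where
  "difference_set K = {x - y | x y. x \<in> K \<and> y \<in> K}"

definition sparse_lattice_property :: "'a::euclidean_space set \<Rightarrow> 'a set \<Rightarrow> bool" where
  "sparse_lattice_property L K \<longleftrightarrow> difference_set K \<inter> L = {0}"

definition fourier_indicator :: "'a::euclidean_space set \<Rightarrow> 'a \<Rightarrow> complex" where
  "fourier_indicator K \<xi> =
     (LINT x:K|lebesgue. exp (- (2 * complex_of_real pi * \<i> * complex_of_real (x \<bullet> \<xi>))))"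

end

(* By linearity the integrals over P and Q agree for every trigonometric polynomial with frequencies
   in the dual lattice, hence, by Stone-Weierstrass on the torus, for every continuous L-periodic
   function. Applied to the distance from the closed periodic set Q + L, this shows that the distance
   vanishes almost everywhere on P, hence on all of P, because P is the closure of its interior.
   So P is contained in Q + L, a disjoint union of translates of Q; any family of these has closed
   union, so the connected set P lies in a single Q + l. By symmetry Q lies in some P + m, and
   sparseness forces l + m = 0. *)

theory Submission
  imports Defs
begin

section \<open>Dual bases, lattice coordinates and the torus\<close>

lemma dual_basis_exists:
  fixes B :: "'a::euclidean_space set"
  assumes "independent B"
  shows "\<exists>\<xi>. \<forall>b\<in>B. \<forall>c\<in>B. \<xi> b \<bullet> c = of_bool (b = c)"
proof -
  have "\<exists>v. \<forall>c\<in>B. v \<bullet> c = of_bool (b = c)" for b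
  proof -
    obtain g :: "'a \<Rightarrow> real" where g: "linear g" "\<forall>c\<in>B. g c = of_bool (b = c)"
      using linear_independent_extend[OF assms, where f = "\<lambda>c. of_bool (b = c)"] by auto
    \<comment> \<open>Riesz representation: the vector representing the real functional
      \<open>g\<close> is its adjoint applied to 1.\<close>
    have "adjoint g 1 \<bullet> c = g c" for c
      using adjoint_works[OF g(1), of c 1] by (simp add: inner_commute)
    with g(2) show ?thesis by (intro exI[of _ "adjoint g 1"]) simp
  qed
  then have "\<forall>b. \<exists>v. \<forall>c\<in>B. v \<bullet> c = of_bool (b = c)" by simp
  from choice[OF this] show ?thesis by blast
qed

text \<open>By \<open>expansion\<close>, the number \<open>\<xi> b \<bullet> x\<close> is the
  coordinate of x along b. Lattice, cell and torus are all described by these coordinates, so that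
  questions about them reduce to one real number per basis vector.\<close>

locale dual_bases =
  fixes B :: "'a::euclidean_space set" and \<xi> :: "'a \<Rightarrow> 'a"
  assumes finite_basis: "finite B"
    and dual: "\<lbrakk>b \<in> B; c \<in> B\<rbrakk> \<Longrightarrow> \<xi> b \<bullet> c = of_bool (b = c)"
    and expansion: "(\<Sum>b\<in>B. (\<xi> b \<bullet> x) *\<^sub>R b) = x"
begin

definition lattice :: "'a set" where
  "lattice = {x. \<forall>b\<in>B. \<xi> b \<bullet> x \<in> \<int>}"

definition cell :: "'a set" where
  "cell = {x. \<forall>b\<in>B. \<xi> b \<bullet> x \<in> {0..1}}"

text \<open>The image of this map is a torus that realises the quotient by the lattice inside a
  Euclidean space.\<close>

definition torus_map :: "'a \<Rightarrow> 'a \<times> 'a" where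
  "torus_map x = (\<Sum>b\<in>B. cos (2 * pi * (\<xi> b \<bullet> x)) *\<^sub>R b, \<Sum>b\<in>B. sin (2 * pi * (\<xi> b \<bullet> x)) *\<^sub>R b)"

lemma inner_dual_sum:
  assumes "b \<in> B"
  shows "\<xi> b \<bullet> (\<Sum>c\<in>B. f c *\<^sub>R c) = f b"
proof -
  have "\<xi> b \<bullet> (\<Sum>c\<in>B. f c *\<^sub>R c) = (\<Sum>c\<in>B. if b = c then f c else 0)"
    using assms by (auto simp: inner_sum_right dual intro!: sum.cong)
  also have "\<dots> = f b"
    using assms finite_basis by simp
  finally show ?thesis .
qed

lemma lattice_eq: "lattice = {\<Sum>b\<in>B. real_of_int (c b) *\<^sub>R b | c. True}"
proof (intro equalityI subsetI)
  fix x assume x: "x \<in> lattice"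
  have "x = (\<Sum>b\<in>B. real_of_int \<lfloor>\<xi> b \<bullet> x\<rfloor> *\<^sub>R b)"
    using x by (subst expansion[of x, symmetric]) (auto simp: lattice_def intro!: sum.cong)
  then show "x \<in> {\<Sum>b\<in>B. real_of_int (c b) *\<^sub>R b | c. True}"
    by (intro CollectI exI[of _ "\<lambda>b. \<lfloor>\<xi> b \<bullet> x\<rfloor>"]) simp
qed (auto simp: lattice_def inner_dual_sum)

lemma lattice_0: "0 \<in> lattice"
  by (simp add: lattice_def)

lemma lattice_add: "x \<in> lattice \<Longrightarrow> y \<in> lattice \<Longrightarrow> x + y \<in> lattice"
  by (simp add: lattice_def inner_add_right)

lemma lattice_diff: "x \<in> lattice \<Longrightarrow> y \<in> lattice \<Longrightarrow> x - y \<in> lattice"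
  by (simp add: lattice_def inner_diff_right)

lemma dual_in_dual_lattice: "b \<in> B \<Longrightarrow> \<xi> b \<in> dual_lattice lattice"
  by (simp add: lattice_def dual_lattice_def)

lemma closed_subset_lattice:
  assumes "S \<subseteq> lattice"
  shows "closed S"
proof (rule discrete_imp_closed)
  \<comment> \<open>By Cauchy-Schwarz, points closer than this have coordinates differing by less
    than 1; for lattice points these differences are integers, hence 0. The summand 1 makes
    positivity immediate.\<close>
  define e where "e = 1 / (1 + (\<Sum>b\<in>B. norm (\<xi> b)))"
  have pos: "1 + (\<Sum>b\<in>B. norm (\<xi> b)) > 0"
    by (smt (verit) sum_nonneg norm_ge_zero)
  then show "0 < e" by (simp add: e_def)
  show "\<forall>x\<in>S. \<forall>y\<in>S. dist y x < e \<longrightarrow> y = x"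
  proof (intro ballI impI)
    fix x y assume xy: "x \<in> S" "y \<in> S" "dist y x < e"
    have "\<xi> b \<bullet> (y - x) = 0" if b: "b \<in> B" for b
    proof -
      have "\<xi> b \<bullet> (y - x) \<in> \<int>"
        using subsetD[OF assms xy(1)] subsetD[OF assms xy(2)] b
        by (simp add: lattice_def inner_diff_right)
      moreover have "norm (\<xi> b) \<le> (\<Sum>b\<in>B. norm (\<xi> b))"
        using finite_basis b by (intro member_le_sum) auto
      then have "\<bar>\<xi> b \<bullet> (y - x)\<bar> \<le> (1 + (\<Sum>b\<in>B. norm (\<xi> b))) * dist y x"
        by (intro order_trans[OF Cauchy_Schwarz_ineq2]) (auto simp: dist_norm intro!: mult_right_mono)
      then have "\<bar>\<xi> b \<bullet> (y - x)\<bar> < 1"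
        using xy(3) pos by (simp add: e_def field_simps)
      ultimately show ?thesis
        using Ints_nonzero_abs_less1 by blast
    qed
    then have "(\<Sum>b\<in>B. (\<xi> b \<bullet> (y - x)) *\<^sub>R b) = 0"
      by simp
    then show "y = x" by (simp add: expansion)
  qed
qed

lemma compact_cell: "compact cell"
proof -
  have "closed cell"
  proof -
    have "cell = (\<Inter>b\<in>B. {x. 0 \<le> \<xi> b \<bullet> x} \<inter> {x. \<xi> b \<bullet> x \<le> 1})"
      by (auto simp: cell_def)
    then show ?thesis
      by (auto intro!: closed_INT closed_Int closed_Collect_le continuous_intros)
  qed
  moreover have "norm x \<le> (\<Sum>b\<in>B. norm b)" if "x \<in> cell" for x
  proof -
    have "norm (\<Sum>b\<in>B. (\<xi> b \<bullet> x) *\<^sub>R b) \<le> (\<Sum>b\<in>B. norm b)"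
      using that by (intro sum_norm_le) (auto simp: cell_def intro!: mult_left_le_one_le)
    then show ?thesis by (simp add: expansion)
  qed
  ultimately show ?thesis
    by (auto simp: compact_eq_bounded_closed bounded_iff)
qed

text \<open>Replacing each coordinate by its fractional part changes x by a lattice vector. The
  torus is therefore already the image of the compact cell.\<close>

lemma cell_covers: "\<exists>y\<in>cell. x - y \<in> lattice"
proof (intro bexI)
  let ?y = "\<Sum>b\<in>B. frac (\<xi> b \<bullet> x) *\<^sub>R b"
  show "?y \<in> cell"
    by (auto simp: cell_def inner_dual_sum frac_lt_1 less_imp_le)
  show "x - ?y \<in> lattice"
    by (auto simp: lattice_def inner_diff_right inner_dual_sum frac_def)
qed

lemma continuous_on_torus_map: "continuous_on S torus_map"
  unfolding torus_map_def by (intro continuous_intros)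

text \<open>Pairing both components with \<open>\<xi> b\<close> recovers cosine and sine of each
  angle, and these determine the coordinate exactly up to an integer.\<close>

lemma torus_map_eq_iff: "torus_map x = torus_map y \<longleftrightarrow> x - y \<in> lattice"
proof -
  have period: "2 * pi * s = 2 * pi * t + 2 * pi * of_int n \<longleftrightarrow> s = t + of_int n" for s t and n :: int
    by (simp flip: distrib_left)
  have "torus_map x = torus_map y \<longleftrightarrow>
      (\<forall>b\<in>B. sin (2 * pi * (\<xi> b \<bullet> x)) = sin (2 * pi * (\<xi> b \<bullet> y)) \<and>
             cos (2 * pi * (\<xi> b \<bullet> x)) = cos (2 * pi * (\<xi> b \<bullet> y)))" (is "_ \<longleftrightarrow> ?R")
  proof
    assume eq: "torus_map x = torus_map y"
    show ?R
    proof
      fix b assume b: "b \<in> B"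
      have "\<xi> b \<bullet> fst (torus_map x) = \<xi> b \<bullet> fst (torus_map y)"
        "\<xi> b \<bullet> snd (torus_map x) = \<xi> b \<bullet> snd (torus_map y)"
        using eq by auto
      then show "sin (2 * pi * (\<xi> b \<bullet> x)) = sin (2 * pi * (\<xi> b \<bullet> y)) \<and>
          cos (2 * pi * (\<xi> b \<bullet> x)) = cos (2 * pi * (\<xi> b \<bullet> y))"
        using b by (simp add: torus_map_def inner_dual_sum)
    qed
  qed (auto simp: torus_map_def)
  also have "\<dots> \<longleftrightarrow> (\<forall>b\<in>B. \<exists>n::int. \<xi> b \<bullet> x = \<xi> b \<bullet> y + n)"
    by (simp only: sin_cos_eq_iff period)
  also have "\<dots> \<longleftrightarrow> x - y \<in> lattice"
    by (auto simp: lattice_def inner_diff_right Ints_def image_iff algebra_simps)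
  finally show ?thesis .
qed

end

lemma full_rank_lattice_dual_bases:
  assumes "full_rank_lattice L"
  shows "\<exists>B \<xi>. dual_bases B \<xi> \<and> L = dual_bases.lattice B \<xi>"
proof -
  obtain B where B: "independent B" "span B = UNIV"
      "L = {\<Sum>b\<in>B. real_of_int (c b) *\<^sub>R b | c. True}"
    using assms by (auto simp: full_rank_lattice_def)
  obtain \<xi> where \<xi>: "\<forall>b\<in>B. \<forall>c\<in>B. \<xi> b \<bullet> c = of_bool (b = c)"
    using dual_basis_exists[OF B(1)] by blast
  have fin: "finite B" using B(1) by (rule finiteI_independent)
  have "(\<Sum>b\<in>B. (\<xi> b \<bullet> x) *\<^sub>R b) = x" for x
  proof (rule linear_eq_on_span[where B = B and f = "\<lambda>x. \<Sum>b\<in>B. (\<xi> b \<bullet> x) *\<^sub>R b" and g = "\<lambda>x. x"])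
    show "linear (\<lambda>x. \<Sum>b\<in>B. (\<xi> b \<bullet> x) *\<^sub>R b)"
      by (intro linearI) (simp_all add: inner_add_right scaleR_left_distrib sum.distrib scaleR_sum_right)
    show "(\<Sum>b\<in>B. (\<xi> b \<bullet> c) *\<^sub>R b) = c" if c: "c \<in> B" for c
    proof -
      have "(\<Sum>b\<in>B. (\<xi> b \<bullet> c) *\<^sub>R b) = (\<Sum>b\<in>B. if c = b then b else 0)"
        using \<xi> c by (intro sum.cong) auto
      also have "\<dots> = c" using fin c by simp
      finally show ?thesis .
    qed
  qed (use B(2) in \<open>auto simp: linear_id[unfolded id_def]\<close>)
  then interpret dual_bases B \<xi>
    using \<xi> fin by unfold_locales auto
  show ?thesis
    using B(3) lattice_eq dual_bases_axioms by auto
qed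

section \<open>Trigonometric polynomials and uniform approximation of periodic functions\<close>

inductive trig_polynomial :: "'a::euclidean_space set \<Rightarrow> ('a \<Rightarrow> complex) \<Rightarrow> bool"
  for L where
  character: "\<xi> \<in> dual_lattice L \<Longrightarrow> trig_polynomial L (\<lambda>x. c * cis (- (2 * pi * (x \<bullet> \<xi>))))"
| add: "\<lbrakk>trig_polynomial L f; trig_polynomial L g\<rbrakk> \<Longrightarrow> trig_polynomial L (\<lambda>x. f x + g x)"

lemma trig_polynomial_const: "trig_polynomial L (\<lambda>x. c)"
  using trig_polynomial.character[of 0 L c] by (simp add: dual_lattice_def)

lemma trig_polynomial_sum:
  assumes "\<And>i. i \<in> I \<Longrightarrow> trig_polynomial L (f i)"
  shows "trig_polynomial L (\<lambda>x. \<Sum>i\<in>I. f i x)"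
  using assms
  by (induction I rule: infinite_finite_induct)
     (auto intro: trig_polynomial.add trig_polynomial_const)

text \<open>Characters multiply by adding their frequencies, and the dual lattice is closed under
  addition; distributivity does the rest.\<close>

lemma trig_polynomial_mult:
  assumes "trig_polynomial L f" "trig_polynomial L g"
  shows "trig_polynomial L (\<lambda>x. f x * g x)"
  using assms(1)
proof induction
  case (character \<xi> c)
  note \<xi> = this
  show ?case using assms(2)
  proof induction
    case (character \<eta> d)
    have "\<xi> + \<eta> \<in> dual_lattice L"
      using \<xi> character by (auto simp: dual_lattice_def inner_add_left)
    note trig_polynomial.character[OF this, of "c * d"]
    moreover have "c * d * cis (- (2 * pi * (x \<bullet> (\<xi> + \<eta>)))) =
        c * cis (- (2 * pi * (x \<bullet> \<xi>))) * (d * cis (- (2 * pi * (x \<bullet> \<eta>))))" for x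
    proof -
      have "cis (- (2 * pi * (x \<bullet> (\<xi> + \<eta>)))) =
          cis (- (2 * pi * (x \<bullet> \<xi>))) * cis (- (2 * pi * (x \<bullet> \<eta>)))"
        by (simp add: cis_mult inner_add_right algebra_simps)
      then show ?thesis by (simp only: mult_ac)
    qed
    ultimately show ?case by simp
  qed (auto simp: distrib_left intro: trig_polynomial.add)
qed (auto simp: distrib_right intro: trig_polynomial.add)

text \<open>Euler's formulas, with the frequencies \<xi> and -\<xi>. The real factor
  \<open>u\<close> is there to absorb the values of a linear functional on basis vectors.\<close>

lemma trig_polynomial_cos_sin:
  assumes "\<xi> \<in> dual_lattice L"
  shows "trig_polynomial L (\<lambda>x. complex_of_real (cos (2 * pi * (\<xi> \<bullet> x)) * u))"
    and "trig_polynomial L (\<lambda>x. complex_of_real (sin (2 * pi * (\<xi> \<bullet> x)) * u))"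
proof -
  have m: "- \<xi> \<in> dual_lattice L"
    using assms by (auto simp: dual_lattice_def)
  have c: "complex_of_real (cos t * u) = u / 2 * cis (- t) + u / 2 * cis t"
    and s: "complex_of_real (sin t * u) = (\<i> * u / 2) * cis (- t) + (- \<i> * u / 2) * cis t" for t
    by (auto simp: complex_eq_iff)
  show "trig_polynomial L (\<lambda>x. complex_of_real (cos (2 * pi * (\<xi> \<bullet> x)) * u))"
    unfolding c
    using trig_polynomial.add[OF trig_polynomial.character[OF assms, of "u / 2"]
        trig_polynomial.character[OF m, of "u / 2"]]
    by (simp add: inner_commute)
  show "trig_polynomial L (\<lambda>x. complex_of_real (sin (2 * pi * (\<xi> \<bullet> x)) * u))"
    unfolding s
    using trig_polynomial.add[OF trig_polynomial.character[OF assms, of "\<i> * u / 2"]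
        trig_polynomial.character[OF m, of "- \<i> * u / 2"]]
    by (simp add: inner_commute)
qed

lemma continuous_on_trig_polynomial: "trig_polynomial L f \<Longrightarrow> continuous_on S f"
  by (induction rule: trig_polynomial.induct) (auto intro!: continuous_intros)

text \<open>A linear functional of \<open>torus_map x\<close> is a real combination of cosines and
  sines whose frequencies are the dual basis vectors, which lie in the dual lattice. Sums and
  products stay within the trigonometric polynomials.\<close>

lemma (in dual_bases) trig_polynomial_real_polynomial_function:
  assumes "real_polynomial_function p"
  shows "trig_polynomial lattice (\<lambda>x. complex_of_real (p (torus_map x)))"
  using assms
proof induction
  case (linear f)
  interpret bounded_linear f by fact
  have "f (torus_map x) = (\<Sum>b\<in>B. cos (2 * pi * (\<xi> b \<bullet> x)) * f (b, 0)) +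
      (\<Sum>b\<in>B. sin (2 * pi * (\<xi> b \<bullet> x)) * f (0, b))" for x
  proof -
    have "torus_map x = (\<Sum>b\<in>B. cos (2 * pi * (\<xi> b \<bullet> x)) *\<^sub>R (b, 0)) +
        (\<Sum>b\<in>B. sin (2 * pi * (\<xi> b \<bullet> x)) *\<^sub>R (0, b))"
      by (simp add: torus_map_def prod_eq_iff fst_sum snd_sum)
    then show ?thesis
      by (simp add: add sum scaleR del: scaleR_Pair)
  qed
  then show ?case
    by (auto intro!: trig_polynomial.add trig_polynomial_sum trig_polynomial_cos_sin
        dual_in_dual_lattice simp del: of_real_mult)
qed (auto intro: trig_polynomial_const trig_polynomial.add trig_polynomial_mult)

lemma (in dual_bases) periodic_approx_trig_polynomial:
  fixes g :: "'a \<Rightarrow> real"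
  assumes cont: "continuous_on UNIV g"
    and periodic: "\<And>x l. l \<in> lattice \<Longrightarrow> g (x + l) = g x"
    and "e > 0"
  shows "\<exists>t. trig_polynomial lattice t \<and> (\<forall>x. norm (t x - complex_of_real (g x)) < e)"
proof -
  define S where "S = torus_map ` cell"
  \<comment> \<open>The function induced by g on the torus: the chosen preimage is arbitrary, but
    any two differ by a lattice vector, so periodicity makes the choice harmless.\<close>
  define G where "G s = g (inv_into UNIV torus_map s)" for s
  have G: "G (torus_map x) = g x" for x
  proof -
    have "torus_map (inv_into UNIV torus_map (torus_map x)) = torus_map x"
      by (simp add: f_inv_into_f)
    then show ?thesis
      unfolding torus_map_eq_iff G_def using periodic[of _ x] by fastforce
  qed
  have S: "compact S"
    unfolding S_def by (intro compact_continuous_image continuous_on_torus_map compact_cell)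
  \<comment> \<open>\<open>torus_map\<close> sends closed subsets of the compact cell to compact
    sets, so it acts as a quotient map and the continuity of g passes to \<open>G\<close>.\<close>
  have "continuous_on S G"
    unfolding continuous_on_closed_vimage[OF compact_imp_closed[OF S]]
  proof (intro allI impI)
    fix C :: "real set" assume "closed C"
    then have "closed (g -` C)"
      using cont by (intro closed_vimage)
    then have "compact (torus_map ` (cell \<inter> g -` C))"
      by (intro compact_continuous_image continuous_on_torus_map compact_Int_closed compact_cell)
    moreover have "torus_map ` (cell \<inter> g -` C) = G -` C \<inter> S"
      by (auto simp: S_def G)
    ultimately show "closed (G -` C \<inter> S)"
      using compact_imp_closed by metis
  qed
  then obtain p where p: "real_polynomial_function p" "\<And>s. s \<in> S \<Longrightarrow> \<bar>G s - p s\<bar> < e"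
    using Stone_Weierstrass_real_polynomial_function[OF S _ \<open>e > 0\<close>] by metis
  \<comment> \<open>Since the cell covers the space modulo the lattice, the estimate on
    \<open>S\<close> becomes uniform in all x.\<close>
  have "torus_map x \<in> S" for x
    using cell_covers[of x] by (force simp: S_def simp flip: torus_map_eq_iff)
  then have "\<bar>p (torus_map x) - g x\<bar> < e" for x
    using p(2)[of "torus_map x"] by (simp add: G abs_minus_commute)
  then have "norm (complex_of_real (p (torus_map x)) - complex_of_real (g x)) < e" for x
    by (simp flip: of_real_diff)
  with trig_polynomial_real_polynomial_function[OF p(1)] show ?thesis by blast
qed

section \<open>Integrals of periodic functions over the two sets\<close>

lemma set_integrable_lebesgue_compact:
  fixes f :: "'a::euclidean_space \<Rightarrow> 'b::{banach, second_countable_topology}"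
  assumes "compact K" "continuous_on K f"
  shows "set_integrable lebesgue K f"
proof -
  have "set_integrable lborel K f"
    using borel_integrable_compact[OF assms] by (simp add: set_integrable_def indicator_def cong: if_cong)
  then show ?thesis
    unfolding set_integrable_def by (simp add: integrable_completion borel_measurable_integrable)
qed

text \<open>The minus sign in \<open>trig_polynomial\<close> is that of
  \<open>fourier_indicator\<close>, so a character integrates to a multiple of a Fourier value.
  Compactness supplies the integrability needed for additivity.\<close>

lemma trig_polynomial_integral_eq:
  assumes "compact P" "compact Q"
    and F: "\<forall>\<xi>\<in>dual_lattice L. fourier_indicator P \<xi> = fourier_indicator Q \<xi>"
    and "trig_polynomial L t"
  shows "(LINT x:P|lebesgue. t x) = (LINT x:Q|lebesgue. t x)"
  using assms(4)
proof induction
  case (character \<xi> c)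
  have "cis (- (2 * pi * (x \<bullet> \<xi>))) = exp (- (2 * complex_of_real pi * \<i> * complex_of_real (x \<bullet> \<xi>)))" for x
    by (simp add: cis_conv_exp mult_ac)
  with F character show ?case
    by (simp add: fourier_indicator_def)
next
  case (add f g)
  then show ?case
    using assms(1,2)
    by (simp add: set_integral_add set_integrable_lebesgue_compact continuous_on_trig_polynomial)
qed

lemma norm_set_integral_le:
  fixes f :: "'a::euclidean_space \<Rightarrow> complex"
  assumes "compact K" "continuous_on K f" "\<And>x. x \<in> K \<Longrightarrow> norm (f x) \<le> e"
  shows "norm (LINT x:K|lebesgue. f x) \<le> e * measure lebesgue K"
proof -
  have "norm (LINT x:K|lebesgue. f x) \<le> (LINT x:K|lebesgue. norm (f x))"
    by (intro set_integral_norm_bound set_integrable_lebesgue_compact assms)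
  also have "\<dots> \<le> (LINT x:K|lebesgue. e)"
    by (intro set_integral_mono set_integrable_lebesgue_compact assms continuous_intros)
  also have "\<dots> = e * measure lebesgue K"
    using lmeasurable_compact[OF assms(1)]
    by (simp add: set_lebesgue_integral_def integrable_on_indicator lmeasurable_iff_integrable)
  finally show ?thesis .
qed

lemma (in dual_bases) periodic_integral_eq:
  fixes g :: "'a \<Rightarrow> real"
  assumes "compact P" "compact Q"
    and F: "\<forall>\<xi>\<in>dual_lattice lattice. fourier_indicator P \<xi> = fourier_indicator Q \<xi>"
    and cont: "continuous_on UNIV g"
    and periodic: "\<And>x l. l \<in> lattice \<Longrightarrow> g (x + l) = g x"
  shows "(LINT x:P|lebesgue. g x) = (LINT x:Q|lebesgue. g x)"
proof -
  let ?g = "\<lambda>x. complex_of_real (g x)"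
  let ?I = "\<lambda>K f. LINT x:K|lebesgue. f x :: complex"
  have contg: "continuous_on K ?g" for K
    using cont by (intro continuous_intros) (auto intro: continuous_on_subset)
  define M where "M = measure lebesgue P + measure lebesgue Q"
  have M: "M \<ge> 0" by (simp add: M_def)
  have "norm (?I P ?g - ?I Q ?g) \<le> e" if "e > 0" for e
  proof -
    \<comment> \<open>The errors over P and Q add up to at most e * M / (1 + M), hence at most e;
      the 1 avoids division by zero when \<open>M\<close> vanishes.\<close>
    have "e / (1 + M) > 0" using that M by simp
    from periodic_approx_trig_polynomial[OF cont periodic this]
    obtain t where t: "trig_polynomial lattice t" "\<And>x. norm (t x - ?g x) < e / (1 + M)"
      by blast
    have diff: "norm (?I K t - ?I K ?g) \<le> e / (1 + M) * measure lebesgue K" if "compact K" for K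
    proof -
      have "?I K t - ?I K ?g = ?I K (\<lambda>x. t x - ?g x)"
        using that t(1) contg
        by (simp add: set_integral_diff set_integrable_lebesgue_compact continuous_on_trig_polynomial)
      moreover have "continuous_on K (\<lambda>x. t x - ?g x)"
        using t(1) contg by (intro continuous_on_diff) (auto intro: continuous_on_trig_polynomial)
      ultimately show ?thesis
        using norm_set_integral_le[OF that _ less_imp_le[OF t(2)]] by simp
    qed
    \<comment> \<open>The integrals of \<open>t\<close> over P and Q coincide and cancel.\<close>
    have "?I P ?g - ?I Q ?g = (?I Q t - ?I Q ?g) - (?I P t - ?I P ?g)"
      using trig_polynomial_integral_eq[OF assms(1,2) F t(1)] by simp
    then have "norm (?I P ?g - ?I Q ?g) \<le> norm (?I Q t - ?I Q ?g) + norm (?I P t - ?I P ?g)"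
      using norm_triangle_ineq4 by metis
    also have "\<dots> \<le> e / (1 + M) * measure lebesgue Q + e / (1 + M) * measure lebesgue P"
      by (intro add_mono diff assms)
    also have "\<dots> = e * (M / (1 + M))"
      unfolding M_def by (simp only: times_divide_eq_left times_divide_eq_right
          add_divide_distrib[symmetric] distrib_left add.commute)
    also have "\<dots> \<le> e * 1"
      using that M by (intro mult_left_mono) auto
    finally show ?thesis by simp
  qed
  then have "?I P ?g = ?I Q ?g"
    by (metis field_le_epsilon norm_le_zero_iff add_0 right_minus_eq)
  then show ?thesis
    by (simp add: set_integral_complex_of_real)
qed

section \<open>Distances, and sets contained in the closure of their interior\<close>

lemma infdist_translate:
  fixes x :: "'a::real_normed_vector"
  shows "infdist (x + l) ((\<lambda>y. y + l) ` A) = infdist x A"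
  by (simp add: infdist_def image_image)

lemma finite_union_of_convex_bodies_compact:
  "finite_union_of_convex_bodies P \<Longrightarrow> compact P"
  by (auto simp: finite_union_of_convex_bodies_def convex_body_def body_def)

text \<open>A convex set with nonempty interior lies in the closure of that interior, and the
  interior of each piece lies in the interior of the union.\<close>

lemma finite_union_of_convex_bodies_subset_closure_interior:
  assumes "finite_union_of_convex_bodies P"
  shows "P \<subseteq> closure (interior P)"
proof
  fix x assume "x \<in> P"
  then obtain K where K: "convex K" "interior K \<noteq> {}" "x \<in> K" "K \<subseteq> P"
    using assms unfolding finite_union_of_convex_bodies_def convex_body_def body_def
    by (metis UnionE Union_upper)
  then have "x \<in> closure (interior K)"
    using convex_closure_interior closure_subset by blast
  then show "x \<in> closure (interior P)"
    using closure_mono[OF interior_mono[OF K(4)]] by blast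
qed

text \<open>A zero integral only gives vanishing almost everywhere. The part of the interior where g
  is positive is open and negligible, hence empty; the closed zero set of g then contains the
  closure of the interior.\<close>

lemma continuous_nonneg_integral_zero_imp_zero:
  fixes g :: "'a::euclidean_space \<Rightarrow> real"
  assumes "compact P" "P \<subseteq> closure (interior P)"
    and cont: "continuous_on UNIV g" and nonneg: "\<And>x. g x \<ge> 0"
    and zero: "(LINT x:P|lebesgue. g x) = 0"
    and "x \<in> P"
  shows "g x = 0"
proof -
  have "set_integrable lebesgue P g"
    using assms(1) continuous_on_subset[OF cont] by (intro set_integrable_lebesgue_compact) auto
  then have "AE x in lebesgue. indicator P x *\<^sub>R g x = 0"
    using zero nonneg unfolding set_integrable_def set_lebesgue_integral_def
    by (subst (asm) integral_nonneg_eq_0_iff_AE) auto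
  then obtain N where N: "negligible N" "{x. indicator P x *\<^sub>R g x \<noteq> 0} \<subseteq> N"
    by (auto simp: eventually_ae_filter negligible_iff_null_sets)
  have "interior P \<inter> {x. g x > 0} \<subseteq> {x. indicator P x *\<^sub>R g x \<noteq> 0}"
    using interior_subset by (auto simp: indicator_def)
  then have "negligible (interior P \<inter> {x. g x > 0})"
    using N by (blast intro: negligible_subset)
  moreover have "open (interior P \<inter> {x. g x > 0})"
    using cont by (intro open_Int open_interior open_Collect_less continuous_intros)
  ultimately have "interior P \<inter> {x. g x > 0} = {}"
    using open_not_negligible by blast
  then have "interior P \<subseteq> {x. g x = 0}"
    using nonneg by (force simp: less_le)
  moreover have "closed {x. g x = 0}"
    using cont by (intro closed_Collect_eq continuous_intros)
  ultimately have "closure (interior P) \<subseteq> {x. g x = 0}"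
    by (rule closure_minimal)
  with assms show ?thesis by blast
qed

section \<open>Covering by lattice translates, and connectedness\<close>

context dual_bases
begin

lemma subset_lattice_translates:
  assumes P: "finite_union_of_convex_bodies P" and Q: "compact Q" "Q \<noteq> {}"
    and F: "\<forall>\<xi>\<in>dual_lattice lattice. fourier_indicator P \<xi> = fourier_indicator Q \<xi>"
  shows "P \<subseteq> {q + l | q l. q \<in> Q \<and> l \<in> lattice}"
proof
  fix x assume x: "x \<in> P"
  let ?U = "{q + l | q l. q \<in> Q \<and> l \<in> lattice}"
  define g where "g x = infdist x ?U" for x
  have clU: "closed ?U"
    using compact_closed_sums[OF Q(1) closed_subset_lattice[OF order_refl]]
    by (rule back_subst[where P = closed]) blast
  \<comment> \<open>\<open>infdist\<close> to the empty set is 0 by convention, so vanishing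
    distance implies membership only for a nonempty closed set.\<close>
  have neU: "?U \<noteq> {}"
    using Q(2) lattice_0 by blast
  have invariant: "(\<lambda>y. y + l) ` ?U = ?U" if l: "l \<in> lattice" for l
  proof (intro equalityI subsetI)
    fix y assume "y \<in> ?U"
    then obtain q m where "y = q + m" "q \<in> Q" "m \<in> lattice" by blast
    then have "y - l = q + (m - l)" "m - l \<in> lattice"
      using lattice_diff l by auto
    then have "y - l \<in> ?U"
      using \<open>q \<in> Q\<close> by blast
    then show "y \<in> (\<lambda>y. y + l) ` ?U"
      by (metis (no_types, lifting) diff_add_cancel image_eqI)
  next
    fix y assume "y \<in> (\<lambda>y. y + l) ` ?U"
    then obtain q m where "y = q + (m + l)" "q \<in> Q" "m \<in> lattice"
      by (auto simp: add.assoc)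
    then show "y \<in> ?U"
      using lattice_add l by blast
  qed
  have "g (x + l) = g x" if "l \<in> lattice" for x l
  proof -
    have "g (x + l) = infdist (x + l) ((\<lambda>y. y + l) ` ?U)"
      by (simp only: invariant[OF that] g_def)
    also have "\<dots> = g x"
      by (simp only: infdist_translate g_def)
    finally show ?thesis .
  qed
  moreover have cont: "continuous_on UNIV g"
    unfolding g_def by (intro continuous_intros)
  ultimately have "(LINT x:P|lebesgue. g x) = (LINT x:Q|lebesgue. g x)"
    using finite_union_of_convex_bodies_compact[OF P] Q(1) F by (intro periodic_integral_eq)
  also have "\<dots> = (LINT x:Q|lebesgue. 0)"
  proof (rule set_lebesgue_integral_cong)
    show "Q \<in> sets lebesgue"
      using Q(1) by (simp add: fmeasurableD lmeasurable_compact)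
    have "q \<in> ?U" if "q \<in> Q" for q
      using that lattice_0 by force
    then show "\<forall>q. q \<in> Q \<longrightarrow> g q = 0"
      by (simp add: g_def)
  qed
  finally have "(LINT x:P|lebesgue. g x) = 0" by simp
  then have "g x = 0"
    using P x cont
    by (intro continuous_nonneg_integral_zero_imp_zero[of P g] finite_union_of_convex_bodies_compact
        finite_union_of_convex_bodies_subset_closure_interior) (auto simp: g_def infdist_nonneg)
  then show "x \<in> ?U"
    unfolding g_def using in_closed_iff_infdist_zero[OF clU neU] by blast
qed

lemma connected_subset_single_translate:
  assumes "connected P" "P \<noteq> {}" "compact Q"
    and sparse: "sparse_lattice_property lattice Q"
    and sub: "P \<subseteq> {q + l | q l. q \<in> Q \<and> l \<in> lattice}"
  shows "\<exists>l\<in>lattice. P \<subseteq> (\<lambda>x. x + l) ` Q"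
proof -
  obtain q l where l: "q \<in> Q" "l \<in> lattice" "q + l \<in> P"
    using assms(2) sub by blast
  \<comment> \<open>One translate that meets P is separated from the union of all the
    others.\<close>
  let ?A = "(\<lambda>x. x + l) ` Q"
  let ?B = "{q + m | q m. q \<in> Q \<and> m \<in> lattice - {l}}"
  have "closed ?A"
    using assms(3) by (intro compact_imp_closed compact_continuous_image continuous_intros)
  moreover have "closed ?B"
    using compact_closed_sums[OF assms(3) closed_subset_lattice[of "lattice - {l}"]]
    by (rule back_subst[where P = closed]) auto
  moreover have "P \<subseteq> ?A \<union> ?B"
    using sub by blast
  \<comment> \<open>A common point would make m - l a nonzero lattice vector in the difference set
    of Q.\<close>
  moreover have "?A \<inter> ?B = {}"
  proof (rule ccontr)
    assume "?A \<inter> ?B \<noteq> {}"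
    then obtain x y m where xy: "x \<in> Q" "y \<in> Q" "x + l = y + m" "m \<in> lattice" "m \<noteq> l"
      by auto
    have "x - y = m - l"
      using xy(3) by (simp add: algebra_simps)
    then have "x - y \<in> lattice"
      using lattice_diff[OF xy(4) l(2)] by simp
    moreover have "x - y \<in> difference_set Q"
      using xy by (auto simp: difference_set_def)
    ultimately have "x - y \<in> difference_set Q \<inter> lattice" by blast
    then have "x - y = 0"
      using sparse unfolding sparse_lattice_property_def by blast
    with xy show False by simp
  qed
  ultimately have "?B \<inter> P = {}"
    using connected_closedD[OF assms(1), of ?A ?B] l by blast
  with \<open>P \<subseteq> ?A \<union> ?B\<close> l(2) show ?thesis by blast
qed

end

theorem theorem1p2:
  fixes L P Q :: "(real ^ 'd) set"
  assumes "full_rank_lattice L"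
    and "connected P" and "finite_union_of_convex_bodies P"
    and "connected Q" and "finite_union_of_convex_bodies Q"
    and "sparse_lattice_property L P" and "sparse_lattice_property L Q"
    and "\<forall>\<xi>\<in>dual_lattice L. fourier_indicator P \<xi> = fourier_indicator Q \<xi>"
  shows "\<exists>l\<in>L. Q = (\<lambda>x. x + l) ` P"
proof -
  obtain B \<xi> where "dual_bases B \<xi>" and L: "L = dual_bases.lattice B \<xi>"
    using full_rank_lattice_dual_bases[OF assms(1)] by blast
  then interpret dual_bases B \<xi> by simp
  note assms = assms[unfolded L]
  \<comment> \<open>A union over an empty family is empty; sparseness excludes this, since it puts 0
    into the difference set.\<close>
  have ne: "P \<noteq> {}" "Q \<noteq> {}"
    using assms(6,7) by (auto simp: sparse_lattice_property_def difference_set_def)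
  note compact = assms(3,5)[THEN finite_union_of_convex_bodies_compact]
  obtain l where l: "l \<in> lattice" "P \<subseteq> (\<lambda>x. x + l) ` Q"
    using connected_subset_single_translate[OF assms(2) ne(1) compact(2) assms(7)
        subset_lattice_translates[OF assms(3) compact(2) ne(2) assms(8)]] by blast
  obtain m where m: "m \<in> lattice" "Q \<subseteq> (\<lambda>x. x + m) ` P"
    using connected_subset_single_translate[OF assms(4) ne(2) compact(1) assms(6)
        subset_lattice_translates[OF assms(5) compact(1) ne(1)]] assms(8) by auto
  \<comment> \<open>Following a point of P into Q and back to P shifts it by l + m in total, so this
    lattice vector lies in the difference set of P.\<close>
  have "l + m = 0"
  proof -
    obtain p q p' where "p \<in> P" "q \<in> Q" "p' \<in> P" "p = q + l" "q = p' + m"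
      using ne(1) l(2) m(2) by blast
    then have "l + m = p - p'" by simp
    then have "l + m \<in> difference_set P \<inter> lattice"
      using \<open>p \<in> P\<close> \<open>p' \<in> P\<close> lattice_add[OF l(1) m(1)] by (auto simp: difference_set_def)
    then show ?thesis
      using assms(6) by (auto simp: sparse_lattice_property_def)
  qed
  then have "l = - m"
    by (simp add: eq_neg_iff_add_eq_0)
  \<comment> \<open>With l = -m, the inclusion of P in Q + l is the converse of the inclusion of Q
    in P + m, so m is the required translation.\<close>
  then have "(\<lambda>x. x + m) ` P \<subseteq> Q"
    using l(2) by force
  with m show ?thesis
    unfolding L by blast
qed

end
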